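(* Quasisobriety of the Smyth power space does not always imply quasisobriety of the space: there exists a $T_0$ topological space $X$ such that $P^s(X)$ is quasisober but $X$ is not quasisober.
   Context: For a topological space $X$, the specialization preorder is $x\le y$ iff $x\in\mathrm{cl}\{y\}$; all order-theoretic notions in $X$ refer to it. For $A\subseteq X$, $A^{\uparrow}$ and $A^{\downarrow}$ denote the sets of all upper, respectively lower, bounds of $A$ in $X$, and $A^{\delta}=(A^{\uparrow})^{\downarrow}$ is the cut closure of $A$. Directed sets and irreducible closed sets are nonempty. A $T_0$ space $X$ is quasisober if every irreducible closed subset of $X$ equals $D^{\delta}$ for some directed subset $D$ of $X$. The Smyth power space $P^s(X)$ is the set $K(X)$ of nonempty compact saturated subsets of $X$ (saturated = intersection of open sets, equivalently an upper set), with the upper Vietoris topology generated by the sets $\Box U=\{K\in K(X):K\subseteq U\}$, $U$ open in $X$; its specialization order is reverse inclusion. *)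

theory Defs
  imports "HOL-Analysis.Analysis"
begin

definition spec_le :: "'a topology \<Rightarrow> 'a \<Rightarrow> 'a \<Rightarrow> bool" where
  "spec_le X x y \<longleftrightarrow> x \<in> topspace X \<and> y \<in> topspace X \<and> x \<in> X closure_of {y}"

definition upper_bounds :: "'a topology \<Rightarrow> 'a set \<Rightarrow> 'a set" where
  "upper_bounds X A = {u \<in> topspace X. \<forall>a\<in>A. spec_le X a u}"

definition lower_bounds :: "'a topology \<Rightarrow> 'a set \<Rightarrow> 'a set" where
  "lower_bounds X A = {l \<in> topspace X. \<forall>a\<in>A. spec_le X l a}"

definition cut_closure :: "'a topology \<Rightarrow> 'a set \<Rightarrow> 'a set" where
  "cut_closure X A = lower_bounds X (upper_bounds X A)"

definition directed_in :: "'a topology \<Rightarrow> 'a set \<Rightarrow> bool" where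
  "directed_in X D \<longleftrightarrow> D \<subseteq> topspace X \<and> D \<noteq> {} \<and>
     (\<forall>x\<in>D. \<forall>y\<in>D. \<exists>z\<in>D. spec_le X x z \<and> spec_le X y z)"

definition irreducible_closedin :: "'a topology \<Rightarrow> 'a set \<Rightarrow> bool" where
  "irreducible_closedin X A \<longleftrightarrow> closedin X A \<and> A \<noteq> {} \<and>
     (\<forall>B C. closedin X B \<and> closedin X C \<and> A \<subseteq> B \<union> C \<longrightarrow> A \<subseteq> B \<or> A \<subseteq> C)"

definition quasisober_space :: "'a topology \<Rightarrow> bool" where
  "quasisober_space X \<longleftrightarrow> t0_space X \<and>
     (\<forall>A. irreducible_closedin X A \<longrightarrow> (\<exists>D. directed_in X D \<and> A = cut_closure X D))"

text \<open>Intersecting with the carrier makes the empty family yield the whole space.\<close>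

definition saturatedin :: "'a topology \<Rightarrow> 'a set \<Rightarrow> bool" where
  "saturatedin X A \<longleftrightarrow> (\<exists>\<U>. (\<forall>U\<in>\<U>. openin X U) \<and> A = topspace X \<inter> \<Inter>\<U>)"

definition compact_saturated_sets :: "'a topology \<Rightarrow> 'a set set" where
  "compact_saturated_sets X = {K. K \<noteq> {} \<and> compactin X K \<and> saturatedin X K}"

definition smyth_box :: "'a topology \<Rightarrow> 'a set \<Rightarrow> 'a set set" where
  "smyth_box X U = {K \<in> compact_saturated_sets X. K \<subseteq> U}"

definition smyth_power_space :: "'a topology \<Rightarrow> 'a set topology" where
  "smyth_power_space X = topology_generated_by {smyth_box X U | U. openin X U}"

lemma topspace_smyth_power_space [simp]:
  "topspace (smyth_power_space X) = compact_saturated_sets X"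
proof -
  have "compact_saturated_sets X \<subseteq> smyth_box X (topspace X)"
    by (auto simp: smyth_box_def compact_saturated_sets_def saturatedin_def)
  moreover have "\<Union>{smyth_box X U | U. openin X U} \<subseteq> compact_saturated_sets X"
    by (auto simp: smyth_box_def)
  moreover have "smyth_box X (topspace X) \<subseteq> \<Union>{smyth_box X U | U. openin X U}"
    by blast
  ultimately show ?thesis
    unfolding smyth_power_space_def topology_generated_by_topspace by (meson order_trans subset_antisym)
qed

lemma openin_smyth_power_space_antimono:
  assumes "openin (smyth_power_space X) \<V>" "K \<in> \<V>" "L \<in> compact_saturated_sets X" "L \<subseteq> K"
  shows "L \<in> \<V>"
proof -
  have "generate_topology_on {smyth_box X U | U. openin X U} \<V>"
    using assms(1) by (simp add: smyth_power_space_def openin_topology_generated_by_iff)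
  then show ?thesis
    using assms(2-4) by induction (auto simp: smyth_box_def)
qed

lemma spec_le_smyth_power_space_iff:
  assumes "K \<in> compact_saturated_sets X" "L \<in> compact_saturated_sets X"
  shows "spec_le (smyth_power_space X) K L \<longleftrightarrow> L \<subseteq> K"
proof
  assume le: "spec_le (smyth_power_space X) K L"
  obtain \<U> where \<U>: "\<forall>U\<in>\<U>. openin X U" "K = topspace X \<inter> \<Inter>\<U>"
    using assms(1) by (auto simp: compact_saturated_sets_def saturatedin_def)
  have "L \<subseteq> U" if "U \<in> \<U>" for U
  proof -
    have "openin (smyth_power_space X) (smyth_box X U)"
      using \<U> that by (auto simp: smyth_power_space_def intro!: topology_generated_by_Basis)
    moreover have "K \<in> smyth_box X U"
      using \<U> that assms by (auto simp: smyth_box_def)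
    ultimately have "L \<in> smyth_box X U"
      using le by (auto simp: spec_le_def in_closure_of)
    then show ?thesis by (simp add: smyth_box_def)
  qed
  moreover have "L \<subseteq> topspace X"
    using assms(2) by (auto simp: compact_saturated_sets_def saturatedin_def)
  ultimately show "L \<subseteq> K" using \<U> by auto
next
  assume "L \<subseteq> K"
  then show "spec_le (smyth_power_space X) K L"
    using assms openin_smyth_power_space_antimono[of X _ K L]
    by (auto simp: spec_le_def in_closure_of)
qed

end

(* The cofinite topology on an infinite set is T1 and irreducible, so its directed subsets are
   singletons and the whole space is not a cut closure.  Every nonempty set is compact and
   saturated, and an irreducible closed family of nonempty sets consists of all K that contain a
   fixed set -S.  That family is the cut closure of the filtered family of complements of finite
   subsets of S; when S is everything, this family has no upper bound. *)

theory Submission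
  imports Defs
begin

definition cofinite_topology :: "'a topology" where
  "cofinite_topology = topology (\<lambda>U. U = {} \<or> finite (- U))"

lemma openin_cofinite_topology:
  "openin cofinite_topology U \<longleftrightarrow> U = {} \<or> finite (- U)"
proof -
  have "istopology (\<lambda>U :: 'a set. U = {} \<or> finite (- U))"
    unfolding istopology_def
  proof (intro conjI allI impI)
    fix \<K> :: "'a set set"
    assume \<K>: "\<forall>K\<in>\<K>. K = {} \<or> finite (- K)"
    show "\<Union>\<K> = {} \<or> finite (- \<Union>\<K>)"
    proof (cases "\<Union>\<K> = {}")
      case False
      then obtain K where "K \<in> \<K>" "K \<noteq> {}" by blast
      with \<K> have "finite (- K)" by blast
      moreover have "- \<Union>\<K> \<subseteq> - K" using \<open>K \<in> \<K>\<close> by blast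
      ultimately show ?thesis by (blast intro: finite_subset)
    qed simp
  qed (auto simp: Compl_Int)
  then show ?thesis
    by (simp add: cofinite_topology_def topology_inverse')
qed

lemma topspace_cofinite_topology [simp]: "topspace cofinite_topology = UNIV"
  by (metis Compl_UNIV_eq finite.emptyI openin_cofinite_topology openin_subset top.extremum_uniqueI)

lemma closedin_cofinite_topology:
  "closedin cofinite_topology C \<longleftrightarrow> finite C \<or> C = UNIV"
  by (auto simp: closedin_def openin_cofinite_topology simp flip: Compl_eq_Diff_UNIV)

lemma t0_space_cofinite_topology: "t0_space cofinite_topology"
  unfolding t0_space_def
proof (intro ballI impI)
  fix x y :: 'a
  assume "x \<noteq> y"
  then show "\<exists>U. openin cofinite_topology U \<and> (x \<notin> U \<longleftrightarrow> y \<in> U)"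
    by (intro exI[of _ "- {x}"]) (auto simp: openin_cofinite_topology)
qed

lemma spec_le_cofinite_topology: "spec_le cofinite_topology x y \<longleftrightarrow> x = y"
  by (auto simp: spec_le_def closure_of_closedin closedin_cofinite_topology)

lemma not_quasisober_cofinite_topology:
  assumes "infinite (UNIV :: 'a set)"
  shows "\<not> quasisober_space (cofinite_topology :: 'a topology)"
proof
  let ?X = "cofinite_topology :: 'a topology"
  assume "quasisober_space ?X"
  moreover have "irreducible_closedin ?X UNIV"
    unfolding irreducible_closedin_def closedin_cofinite_topology
  proof (intro conjI allI impI)
    fix B C :: "'a set"
    assume "(finite B \<or> B = UNIV) \<and> (finite C \<or> C = UNIV) \<and> UNIV \<subseteq> B \<union> C"
    \<comment> \<open>Two finite sets cannot cover the infinite carrier, so one of \<open>B\<close>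
      and \<open>C\<close> is infinite and closed, hence \<open>UNIV\<close>.\<close>
    moreover from this have "infinite (B \<union> C)"
      using assms by (simp add: top.extremum_unique)
    ultimately show "UNIV \<subseteq> B \<or> UNIV \<subseteq> C" by auto
  qed auto
  ultimately obtain D where D: "directed_in ?X D" "cut_closure ?X D = UNIV"
    unfolding quasisober_space_def by metis
  then obtain d where "d \<in> D" "\<forall>x\<in>D. \<forall>y\<in>D. x = y"
    unfolding directed_in_def spec_le_cofinite_topology by (metis ex_in_conv)
  then have "D = {d}" by blast
  \<comment> \<open>Specialization is equality, so \<open>d\<close> is the only upper bound of
    \<open>{d}\<close> and the only lower bound of that.\<close>
  then have "cut_closure ?X D = {d}"
    by (auto simp: cut_closure_def lower_bounds_def upper_bounds_def spec_le_cofinite_topology)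
  with D(2) assms show False
    by (metis finite.emptyI finite_insert)
qed

text \<open>One nonempty member of an open cover already misses only finitely many points, which
  gives compactness. Saturation holds because the space is T1.\<close>

lemma compact_saturated_sets_cofinite_topology:
  "compact_saturated_sets cofinite_topology = {K. K \<noteq> {}}"
proof -
  have "compactin cofinite_topology K" for K :: "'a set"
    unfolding compactin_def
  proof (intro conjI allI impI)
    fix \<U> :: "'a set set"
    assume \<U>: "Ball \<U> (openin cofinite_topology) \<and> K \<subseteq> \<Union>\<U>"
    show "\<exists>\<F>. finite \<F> \<and> \<F> \<subseteq> \<U> \<and> K \<subseteq> \<Union>\<F>"
    proof (cases "K = {}")
      case False
      then obtain U where U: "U \<in> \<U>" "U \<noteq> {}" using \<U> by blast
      then have "finite (K - U)"
        using \<U> by (metis Diff_eq finite_Int openin_cofinite_topology)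
      moreover have "K - U \<subseteq> \<Union>\<U>" using \<U> by blast
      ultimately obtain \<F> where "finite \<F>" "\<F> \<subseteq> \<U>" "K - U \<subseteq> \<Union>\<F>"
        by (metis finite_subset_Union)
      with U show ?thesis by (intro exI[of _ "insert U \<F>"]) auto
    qed blast
  qed simp
  moreover have "saturatedin cofinite_topology K" for K :: "'a set"
    unfolding saturatedin_def
    \<comment> \<open>Removing the points outside \<open>K\<close> one at a time leaves
      \<open>K\<close>; for \<open>K = UNIV\<close> the family is empty and the carrier itself
      results.\<close>
    by (intro exI[of _ "(\<lambda>x. - {x}) ` (- K)"]) (auto simp: openin_cofinite_topology)
  ultimately show ?thesis by (auto simp: compact_saturated_sets_def)
qed

lemma openin_smyth_power_space_box:
  assumes "openin X U"
  shows "openin (smyth_power_space X) (smyth_box X U)"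
  unfolding smyth_power_space_def by (rule topology_generated_by_Basis) (use assms in blast)

text \<open>Boxes commute with binary intersections, so the generating family is a base and not
  merely a subbase.\<close>

lemma smyth_power_space_basis:
  assumes "openin (smyth_power_space X) \<V>" "K \<in> \<V>"
  obtains U where "openin X U" "K \<in> smyth_box X U" "smyth_box X U \<subseteq> \<V>"
proof -
  have "generate_topology_on {smyth_box X U | U. openin X U} \<V>"
    using assms(1) by (simp add: smyth_power_space_def openin_topology_generated_by_iff)
  then have "\<exists>U. openin X U \<and> K \<in> smyth_box X U \<and> smyth_box X U \<subseteq> \<V>"
    using assms(2)
  proof induction
    case (Int \<V> \<W>)
    then have "K \<in> \<V>" "K \<in> \<W>" by simp_all
    then obtain U V where "openin X U" "K \<in> smyth_box X U" "smyth_box X U \<subseteq> \<V>"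
      "openin X V" "K \<in> smyth_box X V" "smyth_box X V \<subseteq> \<W>"
      using Int.IH by metis
    then show ?case
      by (intro exI[of _ "U \<inter> V"]) (auto simp: smyth_box_def)
  next
    case (UN \<K>)
    then obtain \<W> where "\<W> \<in> \<K>" "K \<in> \<W>" by blast
    with UN.IH obtain U where "openin X U" "K \<in> smyth_box X U" "smyth_box X U \<subseteq> \<W>"
      by meson
    with \<open>\<W> \<in> \<K>\<close> show ?case by blast
  next
    case (Basis \<V>)
    then show ?case by blast
  qed simp
  then show thesis using that by blast
qed

text \<open>Specialization is reverse inclusion, which is antisymmetric; no separation axiom on
  \<open>X\<close> enters.\<close>

lemma t0_space_smyth_power_space: "t0_space (smyth_power_space X)"
  unfolding t0_space_def topspace_smyth_power_space
proof (intro ballI impI)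
  fix K L
  assume KL: "K \<in> compact_saturated_sets X" "L \<in> compact_saturated_sets X" "K \<noteq> L"
  then have "\<not> spec_le (smyth_power_space X) K L \<or> \<not> spec_le (smyth_power_space X) L K"
    by (auto simp: spec_le_smyth_power_space_iff)
  with KL show "\<exists>\<V>. openin (smyth_power_space X) \<V> \<and> (K \<notin> \<V> \<longleftrightarrow> L \<in> \<V>)"
    by (auto simp: spec_le_def in_closure_of)
qed

text \<open>The sets that meet a finite \<open>G\<close> form a closed family, the complement of the
  box of \<open>- G\<close>. Meeting \<open>insert x F\<close> means meeting \<open>{x}\<close> or
  \<open>F\<close>, so irreducibility picks one of the two and induction shrinks the finite set to a
  single common point.\<close>

lemma irreducible_closedin_smyth_hit:
  assumes irr: "irreducible_closedin (smyth_power_space cofinite_topology) \<A>"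
    and "finite F" "\<And>K. K \<in> \<A> \<Longrightarrow> K \<inter> F \<noteq> {}"
  shows "\<exists>x\<in>F. \<forall>K\<in>\<A>. x \<in> K"
  using assms(2,3)
proof (induction F)
  case empty
  \<comment> \<open>An irreducible family has a member, and no set meets the empty set.\<close>
  with irr show ?case by (auto simp: irreducible_closedin_def)
next
  case (insert x F)
  let ?P = "smyth_power_space (cofinite_topology :: 'a topology)"
  let ?hit = "\<lambda>G. {K :: 'a set. K \<noteq> {} \<and> K \<inter> G \<noteq> {}}"
  have closed: "closedin ?P (?hit G)" if "finite G" for G
  proof -
    have "openin ?P (smyth_box cofinite_topology (- G))"
      using that by (intro openin_smyth_power_space_box) (simp add: openin_cofinite_topology)
    moreover have "smyth_box cofinite_topology (- G) = topspace ?P - ?hit G"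
      by (auto simp: smyth_box_def compact_saturated_sets_cofinite_topology)
    ultimately show ?thesis
      by (auto simp: closedin_def compact_saturated_sets_cofinite_topology)
  qed
  have "\<A> \<subseteq> ?hit {x} \<union> ?hit F"
  proof
    fix K assume "K \<in> \<A>"
    then have "K \<inter> insert x F \<noteq> {}" by (rule insert.prems)
    then show "K \<in> ?hit {x} \<union> ?hit F" by auto
  qed
  then have "\<A> \<subseteq> ?hit {x} \<or> \<A> \<subseteq> ?hit F"
    using irr closed[of "{x}"] closed[OF insert.hyps(1)]
    by (simp add: irreducible_closedin_def)
  then show ?case
  proof
    assume "\<A> \<subseteq> ?hit {x}"
    then show ?thesis by blast
  next
    assume "\<A> \<subseteq> ?hit F"
    then have "\<exists>y\<in>F. \<forall>K\<in>\<A>. y \<in> K" by (intro insert.IH) blast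
    then show ?thesis by blast
  qed
qed

text \<open>If \<open>K\<close> lies outside \<A>, a box of some open \<open>U\<close> contains
  \<open>K\<close> and misses \<A>. Every member of \<A> then meets the finite set
  \<open>- U\<close>, so all of them share a point of \<open>- U\<close>; that point lies in the
  intersection of \<A> but not in \<open>K\<close>.\<close>

lemma irreducible_closedin_smyth_cofinite:
  assumes irr: "irreducible_closedin (smyth_power_space cofinite_topology) \<A>"
  shows "\<A> = {K. K \<noteq> {} \<and> \<Inter>\<A> \<subseteq> K}"
proof (intro equalityI subsetI)
  let ?P = "smyth_power_space (cofinite_topology :: 'a topology)"
  have closed: "closedin ?P \<A>"
    using irr by (simp add: irreducible_closedin_def)
  fix K
  show "K \<in> {K. K \<noteq> {} \<and> \<Inter>\<A> \<subseteq> K}" if "K \<in> \<A>"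
    using that closedin_subset[OF closed]
    by (auto simp: compact_saturated_sets_cofinite_topology)
  assume K: "K \<in> {K. K \<noteq> {} \<and> \<Inter>\<A> \<subseteq> K}"
  show "K \<in> \<A>"
  proof (rule ccontr)
    assume "K \<notin> \<A>"
    with K closed have "openin ?P (topspace ?P - \<A>)" "K \<in> topspace ?P - \<A>"
      by (auto simp: closedin_def compact_saturated_sets_cofinite_topology)
    then obtain U where U: "openin cofinite_topology U" "K \<in> smyth_box cofinite_topology U"
      "smyth_box cofinite_topology U \<subseteq> topspace ?P - \<A>"
      by (rule smyth_power_space_basis)
    then have KU: "K \<subseteq> U" by (simp add: smyth_box_def)
    \<comment> \<open>Since \<open>K\<close> is nonempty, so is \<open>U\<close>, which rules out
      the empty open set.\<close>
    with K U(1) have "finite (- U)" by (auto simp: openin_cofinite_topology)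
    moreover have "L \<inter> - U \<noteq> {}" if "L \<in> \<A>" for L
      using that U(3) closedin_subset[OF closed] by (auto simp: smyth_box_def)
    ultimately obtain x where "x \<in> - U" "\<forall>L\<in>\<A>. x \<in> L"
      using irreducible_closedin_smyth_hit[OF irr] by blast
    with K KU show False by blast
  qed
qed

lemma quasisober_smyth_cofinite:
  assumes inf: "infinite (UNIV :: 'a set)"
  shows "quasisober_space (smyth_power_space (cofinite_topology :: 'a topology))"
  unfolding quasisober_space_def
proof (intro conjI t0_space_smyth_power_space allI impI)
  let ?P = "smyth_power_space (cofinite_topology :: 'a topology)"
  fix \<A>
  assume "irreducible_closedin ?P \<A>"
  then have \<A>: "\<A> = {K. K \<noteq> {} \<and> \<Inter>\<A> \<subseteq> K}"
    by (rule irreducible_closedin_smyth_cofinite)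
  \<comment> \<open>\<open>spec_le\<close> is false off the carrier, hence the two nonemptiness
    conditions.\<close>
  have le: "spec_le ?P K L \<longleftrightarrow> K \<noteq> {} \<and> L \<noteq> {} \<and> L \<subseteq> K" for K L
    using spec_le_smyth_power_space_iff[of K cofinite_topology L]
    by (auto simp: spec_le_def compact_saturated_sets_cofinite_topology)
  \<comment> \<open>These cofinite sets shrink to the intersection of \<A>, even when that
    intersection is empty and thus not itself a point of the power space.\<close>
  define D where "D = {- F | F. finite F \<and> F \<subseteq> - \<Inter>\<A>}"
  \<comment> \<open>On an infinite carrier no cofinite set is empty, so \<open>D\<close> consists of
    points of the power space.\<close>
  have ne: "K \<noteq> {}" if "K \<in> D" for K
  proof -
    have "finite (- K)" using that by (auto simp: D_def)
    with inf show ?thesis by auto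
  qed
  have "directed_in ?P D"
    unfolding directed_in_def
  proof (intro conjI ballI)
    show "D \<subseteq> topspace ?P"
      using ne by (auto simp: compact_saturated_sets_cofinite_topology)
    show "D \<noteq> {}" by (auto simp: D_def)
    fix K L
    assume "K \<in> D" "L \<in> D"
    then obtain F G where "K = - F" "L = - G" "finite (F \<union> G)" "F \<union> G \<subseteq> - \<Inter>\<A>"
      by (auto simp: D_def)
    then have "K \<inter> L \<in> D" unfolding D_def by (intro CollectI exI[of _ "F \<union> G"]) auto
    with \<open>K \<in> D\<close> \<open>L \<in> D\<close> ne show "\<exists>M\<in>D. spec_le ?P K M \<and> spec_le ?P L M"
      by (intro bexI[of _ "K \<inter> L"]) (auto simp: le)
  qed
  moreover have "cut_closure ?P D = \<A>"
  proof -
    have "\<Inter>D = \<Inter>\<A>"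
    proof
      have "x \<in> \<Inter>\<A>" if "x \<in> \<Inter>D" for x
      proof (rule ccontr)
        assume "x \<notin> \<Inter>\<A>"
        then have "- {x} \<in> D" by (auto simp: D_def)
        with that show False by blast
      qed
      then show "\<Inter>D \<subseteq> \<Inter>\<A>" by blast
    qed (auto simp: D_def)
    moreover have "upper_bounds ?P D = {L. L \<noteq> {} \<and> L \<subseteq> \<Inter>D}"
      unfolding upper_bounds_def le topspace_smyth_power_space
        compact_saturated_sets_cofinite_topology
      using ne by blast
    ultimately have "cut_closure ?P D = {K. K \<noteq> {} \<and> (\<forall>L. L \<noteq> {} \<and> L \<subseteq> \<Inter>\<A> \<longrightarrow> L \<subseteq> K)}"
      by (auto simp: cut_closure_def lower_bounds_def le compact_saturated_sets_cofinite_topology)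
    \<comment> \<open>If the intersection of \<A> is nonempty, take it as \<open>L\<close>; if it is
      empty, there is no such \<open>L\<close>, and both sides contain every nonempty set.\<close>
    also have "\<dots> = {K. K \<noteq> {} \<and> \<Inter>\<A> \<subseteq> K}" by blast
    finally show ?thesis using \<A> by simp
  qed
  ultimately show "\<exists>D. directed_in ?P D \<and> \<A> = cut_closure ?P D" by blast
qed

theorem mainTheorem16:
  shows "\<exists>X :: nat topology.
           t0_space X \<and> quasisober_space (smyth_power_space X) \<and> \<not> quasisober_space X"
  by (intro exI[of _ cofinite_topology] conjI t0_space_cofinite_topology
    quasisober_smyth_cofinite not_quasisober_cofinite_topology infinite_UNIV_nat)

end
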